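(* Let $X$ be a finite set of alternatives with $|X|=m\geq 3$, let $N=\{1,\dots,n\}$ with $n\geq 2$, and let $S\subseteq X$ with $|S|=k$, $1\leq k\leq m$. Let $G_{Pl}$ be plurality rule on $L(X)^N$. (a) If $S$ is in the range of $G_{Pl}$, then $k\leq n$. (b) If $k$ divides $n$, then $S$ is in the range of $G_{Pl}$. (c) If $k=m\leq n$ and $k$ does not divide $n$, then $S$ is not in the range of $G_{Pl}$. (d) If $k<m$ and $$\left\lfloor \frac{n}{k}\right\rfloor>\left\lceil \frac{n-\left\lfloor \frac{n}{k}\right\rfloor k}{m-k}\right\rceil,$$ then $S$ is in the range of $G_{Pl}$.
   Context: $L(X)$ is the set of strong orderings on $X$: complete (any two distinct alternatives are comparable), asymmetric, transitive relations. A profile is $u=(u(1),\dots,u(n))\in L(X)^N$. For $x\in X$ let $n_x(u)$ be the number of individuals $i\in N$ for whom $x$ is the top-ranked alternative of $u(i)$. Plurality rule is $G_{Pl}(u)=\{x\in X: n_x(u)\geq n_z(u)\text{ for all }z\in X\}$. A set $S$ is in the range of $G_{Pl}$ if $G_{Pl}(u)=S$ for some profile $u\in L(X)^N$. *)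

theory Defs
  imports Complex_Main "HOL-Library.FuncSet"
begin

text \<open>A pair \<open>(x, y) \<in> r\<close> means that \<open>x\<close> is ranked strictly above \<open>y\<close>.\<close>

definition strong_orderings :: "'a set \<Rightarrow> 'a rel set" where
  "strong_orderings X = {r. r \<subseteq> X \<times> X \<and> total_on X r \<and> asym r \<and> trans r}"

definition profiles :: "'a set \<Rightarrow> 'i set \<Rightarrow> ('i \<Rightarrow> 'a rel) set" where
  "profiles X N = N \<rightarrow>\<^sub>E strong_orderings X"

definition top_ranked :: "'a set \<Rightarrow> 'a rel \<Rightarrow> 'a \<Rightarrow> bool" where
  "top_ranked X r x \<longleftrightarrow> x \<in> X \<and> (\<forall>y \<in> X - {x}. (x, y) \<in> r)"

definition top_count :: "'a set \<Rightarrow> 'i set \<Rightarrow> ('i \<Rightarrow> 'a rel) \<Rightarrow> 'a \<Rightarrow> nat" where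
  "top_count X N u x = card {i \<in> N. top_ranked X (u i) x}"

definition plurality :: "'a set \<Rightarrow> 'i set \<Rightarrow> ('i \<Rightarrow> 'a rel) \<Rightarrow> 'a set" where
  "plurality X N u = {x \<in> X. \<forall>z \<in> X. top_count X N u x \<ge> top_count X N u z}"

definition plurality_range :: "'a set \<Rightarrow> 'i set \<Rightarrow> 'a set set" where
  "plurality_range X N = plurality X N ` profiles X N"

end

theory Submission
  imports Defs
begin

text \<open>
  Plurality rule sees a profile only through the numbers of first places, and these numbers can be
  prescribed freely: in every strong ordering of a finite nonempty set exactly one alternative is on
  top, so the counts add up to the number of individuals, and conversely every vector of counts with
  that total arises, because every alternative is on top of some strong ordering
  (\<open>ex_strong_ordering_with_top\<close>) and the electorate can be split into blocks of prescribed sizes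
  (\<open>ex_fun_with_fibre_cards\<close>). Hence \<open>S\<close> is in the range iff \<open>S\<close> is the set of maximisers of
  some \<open>c\<close> on \<open>X\<close> with values in the natural numbers and total \<open>n\<close> (\<open>plurality_range_iff\<close>),
  which turns the four claims into arithmetic.

  If such a \<open>c\<close> has maximum \<open>p\<close>, then \<open>p > 0\<close>, since \<open>n > 0\<close>, and \<open>S\<close> uses up \<open>k * p\<close> of the
  total: this gives (a), and also (c), where \<open>S = X\<close> forces \<open>n = k * p\<close>. For (b) and (d), each
  member of \<open>S\<close> receives \<open>q = n div k\<close> votes, and the remaining \<open>n - k * q\<close> votes are spread over
  the \<open>m - k\<close> alternatives outside \<open>S\<close>. All of these stay below \<open>q\<close> as soon as
  \<open>n - k * q \<le> (m - k) * (q - 1)\<close> (\<open>in_plurality_rangeI\<close>); this is trivial when \<open>k\<close> divides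
  \<open>n\<close>, and is what the inequality between floor and ceiling amounts to.
\<close>

section \<open>First places in strong orderings\<close>

text \<open>Asymmetry and transitivity make a finite relation acyclic, hence well-founded; completeness
  turns a minimal element into a top-ranked one.\<close>

lemma ex_top_ranked:
  assumes "finite X" "X \<noteq> {}" "r \<in> strong_orderings X"
  shows "\<exists>x. top_ranked X r x"
proof -
  have r: "r \<subseteq> X \<times> X" "total_on X r" "asym r" "trans r"
    using assms(3) by (auto simp: strong_orderings_def)
  have "finite r"
    using r(1) assms(1) finite_subset by blast
  moreover have "acyclic r"
    using r(3,4) by (auto simp: acyclic_def dest: asymD)
  ultimately have "wf r"
    by (rule finite_acyclic_wf)
  then obtain x where "x \<in> X" "\<And>y. (y, x) \<in> r \<Longrightarrow> y \<notin> X"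
    using assms(2) by (metis wfE_min ex_in_conv)
  then have "top_ranked X r x"
    using r(2) by (auto simp: top_ranked_def total_on_def)
  then show ?thesis ..
qed

lemma top_ranked_unique:
  assumes "r \<in> strong_orderings X" "top_ranked X r x" "top_ranked X r y"
  shows "x = y"
  using assms unfolding top_ranked_def strong_orderings_def by (auto dest: asymD)

lemma ex_strong_ordering_with_top:
  assumes "finite X" "a \<in> X"
  shows "\<exists>r \<in> strong_orderings X. top_ranked X r a"
proof -
  obtain h :: "'a \<Rightarrow> nat" where h: "inj_on h X"
    using finite_imp_inj_to_nat_seg[OF assms(1)] by blast
  \<comment> \<open>Any injective ranking will do, once \<open>a\<close> has been moved to the front.\<close>
  define g where "g x = (if x = a then 0 else Suc (h x))" for x
  have g: "inj_on g X"
    using h by (auto simp: inj_on_def g_def)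
  define r where "r = {(x, y). x \<in> X \<and> y \<in> X \<and> g x < g y}"
  have "total_on X r"
    using g by (auto simp: total_on_def r_def inj_on_def) (metis linorder_neqE_nat)
  moreover have "asym r"
    by (rule asymI) (auto simp: r_def)
  moreover have "trans r"
    by (rule transI) (auto simp: r_def)
  ultimately have "r \<in> strong_orderings X"
    by (auto simp: strong_orderings_def r_def)
  moreover have "top_ranked X r a"
    using assms(2) by (auto simp: top_ranked_def r_def g_def)
  ultimately show ?thesis ..
qed

lemma sum_top_count:
  assumes "finite X" "X \<noteq> {}" "finite N" "u \<in> profiles X N"
  shows "(\<Sum>x\<in>X. top_count X N u x) = card N"
proof -
  have u: "u i \<in> strong_orderings X" if "i \<in> N" for i
    using assms(4) that by (auto simp: profiles_def)
  have "\<forall>x\<in>X. \<forall>y\<in>X. x \<noteq> y \<longrightarrow>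
      {i \<in> N. top_ranked X (u i) x} \<inter> {i \<in> N. top_ranked X (u i) y} = {}"
    using top_ranked_unique[OF u] by blast
  then have "(\<Sum>x\<in>X. top_count X N u x) = card (\<Union>x\<in>X. {i \<in> N. top_ranked X (u i) x})"
    unfolding top_count_def using assms(1,3) by (intro card_UN_disjoint[symmetric]) auto
  also have "(\<Union>x\<in>X. {i \<in> N. top_ranked X (u i) x}) = N"
    using ex_top_ranked[OF assms(1,2) u] by (auto simp: top_ranked_def)
  finally show ?thesis .
qed

section \<open>Prescribing the numbers of first places\<close>

text \<open>The disjoint union of blocks of sizes \<open>c x\<close> has as many elements as \<open>N\<close>; carry the block
  label over along a bijection.\<close>

lemma ex_fun_with_fibre_cards:
  fixes c :: "'a \<Rightarrow> nat"
  assumes "finite X" "finite N" "sum c X = card N"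
  shows "\<exists>f \<in> N \<rightarrow> X. \<forall>x\<in>X. card {i \<in> N. f i = x} = c x"
proof -
  define B where "B = (SIGMA x:X. {..<c x})"
  have "finite B" "card B = card N"
    using assms by (auto simp: B_def)
  then obtain g where g: "bij_betw g N B"
    using assms(2) by (metis finite_same_card_bij)
  have "(fst \<circ> g) \<in> N \<rightarrow> X"
    using bij_betwE[OF g] by (auto simp: B_def)
  moreover have "card {i \<in> N. (fst \<circ> g) i = x} = c x" if "x \<in> X" for x
  proof -
    have "g ` {i \<in> N. (fst \<circ> g) i = x} = {b \<in> B. fst b = x}"
      using bij_betw_imp_surj_on[OF g] by auto
    moreover have "inj_on g {i \<in> N. (fst \<circ> g) i = x}"
      using bij_betw_imp_inj_on[OF g] by (rule inj_on_subset) auto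
    then have "card (g ` {i \<in> N. (fst \<circ> g) i = x}) = card {i \<in> N. (fst \<circ> g) i = x}"
      by (rule card_image)
    ultimately have "card {i \<in> N. (fst \<circ> g) i = x} = card {b \<in> B. fst b = x}"
      by argo
    also have "{b \<in> B. fst b = x} = {x} \<times> {..<c x}"
      using that by (auto simp: B_def)
    finally show ?thesis
      by (simp add: card_cartesian_product)
  qed
  ultimately show ?thesis
    by blast
qed

lemma ex_profile_with_top_count:
  assumes "finite X" "finite N" "sum c X = card N"
  shows "\<exists>u \<in> profiles X N. \<forall>x\<in>X. top_count X N u x = c x"
proof -
  obtain f where f: "f \<in> N \<rightarrow> X" "\<forall>x\<in>X. card {i \<in> N. f i = x} = c x"
    using ex_fun_with_fibre_cards[OF assms] by blast
  have "\<forall>i\<in>N. \<exists>r \<in> strong_orderings X. top_ranked X r (f i)"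
    using ex_strong_ordering_with_top[OF assms(1)] f(1) by blast
  then obtain v where v: "\<forall>i\<in>N. v i \<in> strong_orderings X \<and> top_ranked X (v i) (f i)"
    by metis
  define u where "u = restrict v N"
  have "u \<in> profiles X N"
    using v by (auto simp: u_def profiles_def)
  moreover have "top_count X N u x = c x" if "x \<in> X" for x
  proof -
    have "{i \<in> N. top_ranked X (u i) x} = {i \<in> N. f i = x}"
      using v top_ranked_unique by (fastforce simp: u_def)
    then show ?thesis
      using f(2) that by (simp add: top_count_def)
  qed
  ultimately show ?thesis
    by blast
qed

section \<open>The range of plurality rule\<close>

lemma plurality_range_iff:
  assumes "finite X" "X \<noteq> {}" "finite N"
  shows "S \<in> plurality_range X N \<longleftrightarrow>
    (\<exists>c :: 'a \<Rightarrow> nat. sum c X = card N \<and> S = {x \<in> X. \<forall>z\<in>X. c z \<le> c x})"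
proof
  assume "S \<in> plurality_range X N"
  then obtain u where "u \<in> profiles X N" "S = plurality X N u"
    by (auto simp: plurality_range_def)
  then show "\<exists>c :: 'a \<Rightarrow> nat. sum c X = card N \<and> S = {x \<in> X. \<forall>z\<in>X. c z \<le> c x}"
    using sum_top_count[OF assms] unfolding plurality_def by blast
next
  assume "\<exists>c :: 'a \<Rightarrow> nat. sum c X = card N \<and> S = {x \<in> X. \<forall>z\<in>X. c z \<le> c x}"
  then obtain c :: "'a \<Rightarrow> nat"
    where c: "sum c X = card N" "S = {x \<in> X. \<forall>z\<in>X. c z \<le> c x}"
    by blast
  obtain u where "u \<in> profiles X N" "\<forall>x\<in>X. top_count X N u x = c x"
    using ex_profile_with_top_count[OF assms(1,3) c(1)] by blast
  moreover from this have "plurality X N u = S"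
    by (auto simp: plurality_def c(2))
  ultimately show "S \<in> plurality_range X N"
    by (auto simp: plurality_range_def)
qed

lemma plurality_range_max_count:
  assumes "finite X" "finite N" "N \<noteq> {}" "S \<noteq> {}" "S \<subseteq> X" "S \<in> plurality_range X N"
  obtains p where "p > 0" "card S * p \<le> card N" "S = X \<Longrightarrow> card N = card S * p"
proof -
  have X: "X \<noteq> {}"
    using assms(4,5) by blast
  obtain c :: "'a \<Rightarrow> nat"
    where c: "sum c X = card N" "S = {x \<in> X. \<forall>z\<in>X. c z \<le> c x}"
    using assms(6) plurality_range_iff[OF assms(1) X assms(2)] by blast
  obtain s where s: "s \<in> S"
    using assms(4) by blast
  have eq: "c x = c s" if "x \<in> S" for x
    using s that c(2) by (auto intro: antisym)
  have S: "sum c S = card S * c s"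
    using eq by simp
  have "c s > 0"
  proof (rule ccontr)
    assume "\<not> c s > 0"
    then have "\<forall>x\<in>X. c x = 0"
      using s c(2) by auto
    then show False
      using c(1) assms(2,3) by simp
  qed
  moreover have "card S * c s \<le> card N"
    using sum_mono2[OF assms(1,5), of c] S c(1) by simp
  moreover have "card N = card S * c s" if "S = X"
    using S c(1) that by simp
  ultimately show thesis
    by (rule that)
qed

lemma ex_bounded_with_sum:
  fixes r b :: nat
  assumes "finite A" "r \<le> card A * b"
  shows "\<exists>d. sum d A = r \<and> (\<forall>x\<in>A. d x \<le> b)"
  using assms
proof (induction A arbitrary: r)
  case empty
  then show ?case by simp
next
  case (insert a A)
  then have "r - min r b \<le> card A * b"
    by auto
  then obtain d where d: "sum d A = r - min r b" "\<forall>x\<in>A. d x \<le> b"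
    using insert.IH by blast
  have "sum (d(a := min r b)) A = sum d A"
    using insert.hyps by (intro sum.cong) auto
  then have "sum (d(a := min r b)) (insert a A) = r"
    using insert.hyps d(1) by simp
  moreover have "\<forall>x\<in>insert a A. (d(a := min r b)) x \<le> b"
    using d(2) by auto
  ultimately show ?case
    by blast
qed

text \<open>A count of \<open>q\<close> for every member of \<open>S\<close> leaves a surplus that the other alternatives must
  absorb with at most \<open>q - 1\<close> first places each.\<close>

lemma in_plurality_rangeI:
  assumes "finite X" "finite N" "S \<noteq> {}" "S \<subseteq> X" "q > 0"
    and "card S * q \<le> card N" "card N - card S * q \<le> card (X - S) * (q - 1)"
  shows "S \<in> plurality_range X N"
proof -
  have X: "X \<noteq> {}"
    using assms(3,4) by blast
  obtain d where d: "sum d (X - S) = card N - card S * q" "\<forall>x\<in>X - S. d x \<le> q - 1"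
    using ex_bounded_with_sum[OF _ assms(7)] assms(1) by blast
  define c where "c x = (if x \<in> S then q else d x)" for x
  have "sum c X = sum c (X - S) + sum c S"
    using assms(1,4) by (rule sum.subset_diff[rotated])
  also have "sum c (X - S) = sum d (X - S)"
    by (intro sum.cong) (auto simp: c_def)
  also have "sum c S = card S * q"
    by (simp add: c_def)
  finally have "sum c X = card N"
    using d(1) assms(6) by simp
  moreover have "S = {x \<in> X. \<forall>z\<in>X. c z \<le> c x}"
  proof -
    have inside: "c x = q" if "x \<in> S" for x
      using that by (simp add: c_def)
    have outside: "c x < q" if "x \<in> X" "x \<notin> S" for x
      using d(2) that assms(5) by (force simp: c_def)
    have "c z \<le> q" if "z \<in> X" for z
      using inside outside that by (cases "z \<in> S") (simp_all add: less_imp_le)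
    moreover obtain s where "s \<in> S" "s \<in> X"
      using assms(3,4) by blast
    ultimately show ?thesis
      using inside outside assms(4) by (auto simp: subset_iff) (metis leD)
  qed
  ultimately show ?thesis
    using plurality_range_iff[OF assms(1) X assms(2)] by blast
qed

text \<open>A real number is at most its ceiling, and a strict inequality between integers leaves a gap
  of one; so the condition bounds the average surplus by \<open>n div k - 1\<close>.\<close>

lemma floor_gt_ceiling_imp_surplus_le:
  fixes n k m :: nat
  assumes "0 < k" "k < m"
    and gt: "\<lfloor>real n / real k\<rfloor>
      > \<lceil>(real n - of_int \<lfloor>real n / real k\<rfloor> * real k) / (real m - real k)\<rceil>"
  shows "0 < n div k" "n - k * (n div k) \<le> (m - k) * (n div k - 1)"
proof -
  define q where "q = n div k"
  have fl: "\<lfloor>real n / real k\<rfloor> = int q"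
    by (simp add: q_def floor_divide_of_nat_eq)
  have kq: "k * q \<le> n"
    by (simp add: q_def)
  have r: "real n - of_int (int q) * real k = real (n - k * q)"
    using kq by (simp add: of_nat_diff mult.commute)
  have mk: "real m - real k = real (m - k)"
    using assms(2) by simp
  have le: "\<lceil>real (n - k * q) / real (m - k)\<rceil> \<le> int q - 1"
    using gt unfolding fl r mk by simp
  have "0 \<le> \<lceil>real (n - k * q) / real (m - k)\<rceil>"
    by (subst zero_le_ceiling, rule less_le_trans[of _ 0]) simp_all
  with le have q: "0 < q"
    by linarith
  then show "0 < n div k"
    by (simp add: q_def)
  have "real (n - k * q) / real (m - k) \<le> real_of_int (int q - 1)"
    using le by (simp only: ceiling_le_iff)
  also have "real_of_int (int q - 1) = real (q - 1)"
    using q by (simp add: of_nat_diff)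
  finally have "real (n - k * q) \<le> real ((m - k) * (q - 1))"
    using assms(2) by (simp add: divide_le_eq mult.commute split: if_splits)
  then show "n - k * (n div k) \<le> (m - k) * (n div k - 1)"
    unfolding q_def by linarith
qed

theorem mainTheorem4:
  fixes X S :: "'a set" and N :: "nat set" and m n k :: nat
  assumes "finite X" and "card X = m" and "m \<ge> 3"
    and "N = {1..n}" and "n \<ge> 2"
    and "S \<subseteq> X" and "card S = k" and "1 \<le> k" and "k \<le> m"
  shows "(S \<in> plurality_range X N \<longrightarrow> k \<le> n) \<and>
    (k dvd n \<longrightarrow> S \<in> plurality_range X N) \<and>
    (k = m \<and> m \<le> n \<and> \<not> k dvd n \<longrightarrow> S \<notin> plurality_range X N) \<and>
    (k < m \<and>
       \<lfloor>real n / real k\<rfloor>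
         > \<lceil>(real n - of_int \<lfloor>real n / real k\<rfloor> * real k) / (real m - real k)\<rceil>
     \<longrightarrow> S \<in> plurality_range X N)"
proof -
  have N: "finite N" "N \<noteq> {}" "card N = n"
    using assms(4,5) by auto
  have S: "S \<noteq> {}"
    using assms(7,8) by auto
  have XS: "card (X - S) = m - k"
    using assms(1,2,6,7) by (metis card_Diff_subset finite_subset)
  note max_count = plurality_range_max_count[OF assms(1) N(1,2) S assms(6),
      unfolded N(3) assms(7)]
  note rangeI = in_plurality_rangeI[OF assms(1) N(1) S assms(6),
      unfolded N(3) XS assms(7), of "n div k"]
  show ?thesis
  proof (intro conjI impI)
    assume "S \<in> plurality_range X N"
    then obtain p where "p > 0" "k * p \<le> n"
      using max_count by metis
    then show "k \<le> n"
      by (metis One_nat_def Suc_leI le_trans mult.right_neutral mult_le_mono2)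
  next
    assume "k dvd n"
    with assms(5,8) show "S \<in> plurality_range X N"
      by (intro rangeI) (auto simp: div_greater_zero_iff dvd_imp_le)
  next
    assume k: "k = m \<and> m \<le> n \<and> \<not> k dvd n"
    then have "S = X"
      using assms(1,2,6,7) card_subset_eq by metis
    show "S \<notin> plurality_range X N"
    proof
      assume "S \<in> plurality_range X N"
      then obtain p where "n = k * p"
        using max_count \<open>S = X\<close> by metis
      with k show False
        by simp
    qed
  next
    assume "k < m \<and> \<lfloor>real n / real k\<rfloor>
      > \<lceil>(real n - of_int \<lfloor>real n / real k\<rfloor> * real k) / (real m - real k)\<rceil>"
    then have "0 < n div k" "n - k * (n div k) \<le> (m - k) * (n div k - 1)"
      using floor_gt_ceiling_imp_surplus_le[of k m n] assms(8) by simp_all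
    then show "S \<in> plurality_range X N"
      by (intro rangeI) simp_all
  qed
qed

end
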